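(* Let $G$ be a finite almost simple group, $S=\mathrm{soc}(G)$, and $N=N_{\mathrm{Sym}(G)}(S^* )$. Then $N=D(2,G)$.
   Context: $G$ is almost simple if $\mathrm{soc}(G)$ is a nonabelian simple group. For $L\le G$, $L_{left}$ and $L_{right}$ are the subgroups of $\mathrm{Sym}(G)$ formed by the permutations $g\mapsto xg$ and $g\mapsto gx$ ($x\in L$), and $L^*=L_{left}L_{right}$. $\mathrm{Hol}(G)=N_{\mathrm{Sym}(G)}(G_{right})$, and $D(2,G)$ is the subgroup of $\mathrm{Sym}(G)$ generated by $\mathrm{Hol}(G)$ and $\sigma:g\mapsto g^{-1}$. *)

theory Defs
  imports "HOL-Algebra.Group_Action" "HOL-Algebra.Generated_Groups" "HOL-Algebra.SimpleGroups"
begin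

definition minimal_normal :: "('a, 'b) monoid_scheme \<Rightarrow> 'a set \<Rightarrow> bool" where
  "minimal_normal G M \<longleftrightarrow>
     M \<lhd> G \<and> M \<noteq> {\<one>\<^bsub>G\<^esub>} \<and> (\<forall>K. K \<lhd> G \<and> K \<subseteq> M \<longrightarrow> K = {\<one>\<^bsub>G\<^esub>} \<or> K = M)"

definition socle :: "('a, 'b) monoid_scheme \<Rightarrow> 'a set" where
  "socle G = generate G (\<Union>{M. minimal_normal G M})"

definition almost_simple :: "('a, 'b) monoid_scheme \<Rightarrow> bool" where
  "almost_simple G \<longleftrightarrow>
     group G \<and> simple_group (G\<lparr>carrier := socle G\<rparr>) \<and> \<not> comm_group (G\<lparr>carrier := socle G\<rparr>)"

(* BijGroup composes from right to left and consists of functions that are undefined outside the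
   underlying set, hence the bounded abstractions below.  The order of composition does not affect
   which subsets are subgroups, nor normalizers or generated subgroups. *)

abbreviation Sym :: "('a, 'b) monoid_scheme \<Rightarrow> ('a \<Rightarrow> 'a) monoid" where
  "Sym G \<equiv> BijGroup (carrier G)"

definition left_mults :: "('a, 'b) monoid_scheme \<Rightarrow> 'a set \<Rightarrow> ('a \<Rightarrow> 'a) set" where
  "left_mults G L = {\<lambda>g\<in>carrier G. x \<otimes>\<^bsub>G\<^esub> g | x. x \<in> L}"

definition right_mults :: "('a, 'b) monoid_scheme \<Rightarrow> 'a set \<Rightarrow> ('a \<Rightarrow> 'a) set" where
  "right_mults G L = {\<lambda>g\<in>carrier G. g \<otimes>\<^bsub>G\<^esub> x | x. x \<in> L}"

definition star :: "('a, 'b) monoid_scheme \<Rightarrow> 'a set \<Rightarrow> ('a \<Rightarrow> 'a) set" where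
  "star G L = left_mults G L <#>\<^bsub>Sym G\<^esub> right_mults G L"

definition Hol :: "('a, 'b) monoid_scheme \<Rightarrow> ('a \<Rightarrow> 'a) set" where
  "Hol G = normalizer (Sym G) (right_mults G (carrier G))"

definition D2 :: "('a, 'b) monoid_scheme \<Rightarrow> ('a \<Rightarrow> 'a) set" where
  "D2 G = generate (Sym G) (Hol G \<union> {\<lambda>g\<in>carrier G. inv\<^bsub>G\<^esub> g})"

end

theory Submission
  imports Defs
begin

text \<open>The group \<open>S\<^sup>*\<close> is a product of two commuting nonabelian simple factors, the left and the right
  multiplications by \<open>S\<close>, so anything normalizing it permutes these two factors. The inversion swaps
  them, so it suffices to treat a permutation \<open>f\<close> that preserves both; moreover we may assume that
  it fixes the identity. Then \<open>f (s g) = f s f g\<close> and \<open>f (g s) = f g f s\<close> for \<open>s\<close> in \<open>S\<close>. Hence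
  \<open>f (x y)\<close> and \<open>f x f y\<close> induce the same conjugation on \<open>S\<close>, and they agree because \<open>S\<close> has trivial
  centralizer in \<open>G\<close>. So \<open>f\<close> is an automorphism. Conversely, the holomorph normalizes \<open>S\<^sup>*\<close>
  because the socle is characteristic.\<close>

section \<open>Conjugation and normalizers, in groups and in symmetric groups\<close>

lemma (in group) normalizer_iff:
  assumes "T \<subseteq> carrier G"
  shows "f \<in> normalizer G T \<longleftrightarrow> f \<in> carrier G \<and> (\<lambda>t. f \<otimes> t \<otimes> inv f) ` T = T"
proof -
  have "f <# T #> inv f = (\<lambda>t. f \<otimes> t \<otimes> inv f) ` T"
    by (auto simp: l_coset_def r_coset_def)
  then show ?thesis
    using assms by (auto simp: normalizer_def stabilizer_def)
qed

lemma (in group) conj_eq_iff: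
  assumes "f \<in> carrier G" "t \<in> carrier G" "u \<in> carrier G"
  shows "f \<otimes> t \<otimes> inv f = u \<longleftrightarrow> f \<otimes> t = u \<otimes> f"
  using assms by (metis inv_solve_right' m_closed)

lemma (in group) inj_on_conj:
  assumes "f \<in> carrier G"
  shows "inj_on (\<lambda>t. f \<otimes> t \<otimes> inv f) (carrier G)"
  using assms by (intro inj_onI) simp

lemma (in group) conj_hom:
  assumes "f \<in> carrier G"
  shows "(\<lambda>t. f \<otimes> t \<otimes> inv f) \<in> hom G G"
proof (rule homI)
  fix x y assume "x \<in> carrier G" "y \<in> carrier G"
  then show "f \<otimes> (x \<otimes> y) \<otimes> inv f = f \<otimes> x \<otimes> inv f \<otimes> (f \<otimes> y \<otimes> inv f)"
    using assms by (simp add: m_assoc inv_solve_left)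
qed (use assms in auto)

text \<open>Conjugation is injective, so on a finite set mapping into \<open>T\<close> already means
  mapping onto \<open>T\<close>. The inverse of \<open>f\<close> is cleared from the equation so
  that in a symmetric group it can be read pointwise.\<close>

lemma (in group) finite_normalizer_iff:
  assumes "T \<subseteq> carrier G" "finite T"
  shows "f \<in> normalizer G T \<longleftrightarrow> f \<in> carrier G \<and> (\<forall>t\<in>T. \<exists>u\<in>T. f \<otimes> t = u \<otimes> f)"
proof (cases "f \<in> carrier G")
  case True
  let ?c = "\<lambda>t. f \<otimes> t \<otimes> inv f"
  have "?c ` T = T \<longleftrightarrow> ?c ` T \<subseteq> T"
    using inj_on_conj[OF True] assms
    by (metis endo_inj_surj inj_on_subset equalityD1)
  moreover have "?c t \<in> T \<longleftrightarrow> (\<exists>u\<in>T. f \<otimes> t = u \<otimes> f)" if "t \<in> T" for t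
    using conj_eq_iff[OF True] assms(1) that by (metis subsetD)
  ultimately show ?thesis
    using normalizer_iff[OF assms(1)] True by (auto simp: image_subset_iff)
qed (use assms in \<open>simp add: normalizer_iff\<close>)

lemma normalizer_BijGroup_iff:
  assumes "T \<subseteq> Bij X" "finite T"
  shows "f \<in> normalizer (BijGroup X) T \<longleftrightarrow>
    f \<in> Bij X \<and> (\<forall>t\<in>T. \<exists>u\<in>T. \<forall>x\<in>X. f (t x) = u (f x))"
proof -
  interpret group "BijGroup X" by (rule group_BijGroup)
  have "f \<otimes>\<^bsub>BijGroup X\<^esub> t = u \<otimes>\<^bsub>BijGroup X\<^esub> f \<longleftrightarrow> (\<forall>x\<in>X. f (t x) = u (f x))"
    if "f \<in> Bij X" "t \<in> T" "u \<in> T" for t u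
  proof -
    have "t \<in> Bij X" "u \<in> Bij X" using that assms by auto
    with that show ?thesis
      by (auto simp: BijGroup_def compose_def fun_eq_iff)
  qed
  then show ?thesis
    using assms finite_normalizer_iff[of T f] by (auto simp: BijGroup_def)
qed

section \<open>Commuting simple factors\<close>

text \<open>Rephrases simplicity of \<open>K\<close> with the operations and inverses of the ambient
  group, so that later arguments never leave \<open>G\<close>.\<close>

lemma (in group) simple_subgroupD:
  assumes "subgroup K G" "simple_group (G\<lparr>carrier := K\<rparr>)"
    and "subgroup J G" "J \<subseteq> K" "\<And>k j. k \<in> K \<Longrightarrow> j \<in> J \<Longrightarrow> k \<otimes> j \<otimes> inv k \<in> J"
  shows "J = {\<one>} \<or> J = K"
proof -
  interpret K: group "G\<lparr>carrier := K\<rparr>"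
    using assms(1) subgroup_imp_group by blast
  have "J \<lhd> G\<lparr>carrier := K\<rparr>"
    using assms(1,3,4,5) by (intro K.normal_invI) (auto simp: subgroup_incl m_inv_consistent)
  then show ?thesis
    using simple_group.no_real_normal_subgroup[OF assms(2)] by auto
qed

text \<open>Write \<open>t = a \<otimes> b\<close> with \<open>a\<close> in \<open>L\<close> and
  \<open>b\<close> in \<open>R\<close>. As \<open>b\<close> commutes with \<open>L\<close>,
  conjugation by \<open>t\<close> acts on \<open>L\<close> as conjugation by \<open>a\<close>;
  likewise it acts on \<open>R\<close> as conjugation by \<open>b\<close>.\<close>

lemma (in group) commuting_product_normalizes:
  assumes L: "subgroup L G" and R: "subgroup R G"
    and comm: "\<And>l r. l \<in> L \<Longrightarrow> r \<in> R \<Longrightarrow> l \<otimes> r = r \<otimes> l"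
    and t: "t \<in> L <#> R"
  shows "k \<in> L \<Longrightarrow> t \<otimes> k \<otimes> inv t \<in> L" and "k \<in> R \<Longrightarrow> t \<otimes> k \<otimes> inv t \<in> R"
proof -
  \<comment> \<open>Kept general in the two subgroups: since
    \<open>a \<otimes> b = b \<otimes> a\<close>, exchanging their roles yields the claim for
    \<open>R\<close>.\<close>
  have left: "t \<otimes> k \<otimes> inv t \<in> L"
    if L: "subgroup L G" and R: "subgroup R G" and ab: "a \<in> L" "b \<in> R" "t = a \<otimes> b"
      and comm: "\<And>l r. l \<in> L \<Longrightarrow> r \<in> R \<Longrightarrow> l \<otimes> r = r \<otimes> l" and k: "k \<in> L" for L R a b
  proof -
    note [simp] = subgroup.mem_carrier[OF L] subgroup.mem_carrier[OF R]
    have "inv a \<otimes> (a \<otimes> b) = b"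
      using ab by (simp flip: m_assoc)
    then have "a \<otimes> k \<otimes> inv a \<otimes> (a \<otimes> b) = a \<otimes> k \<otimes> b"
      using ab k by (simp add: m_assoc)
    also have "\<dots> = a \<otimes> b \<otimes> k"
      using ab k by (simp add: m_assoc comm)
    finally have "t \<otimes> k \<otimes> inv t = a \<otimes> k \<otimes> inv a"
      using ab k by (subst conj_eq_iff) auto
    then show ?thesis
      using ab k L by (simp add: subgroup.m_closed subgroup.m_inv_closed)
  qed
  from t obtain a b where ab: "a \<in> L" "b \<in> R" "t = a \<otimes> b"
    unfolding set_mult_def by blast
  show "k \<in> L \<Longrightarrow> t \<otimes> k \<otimes> inv t \<in> L"
    using left[OF L R ab comm] by simp
  show "k \<in> R \<Longrightarrow> t \<otimes> k \<otimes> inv t \<in> R"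
    using left[OF R L ab(2,1)] ab comm by simp
qed

text \<open>Otherwise \<open>K\<close> meets both factors trivially; since all three normalize each other,
  \<open>K\<close> then centralizes \<open>L <#> R\<close>, hence itself.\<close>

lemma (in group) simple_subgroup_of_commuting_product:
  assumes L: "subgroup L G" and R: "subgroup R G" and K: "subgroup K G"
    and comm: "\<And>l r. l \<in> L \<Longrightarrow> r \<in> R \<Longrightarrow> l \<otimes> r = r \<otimes> l"
    and K_LR: "K \<subseteq> L <#> R"
    and norm: "\<And>t k. t \<in> L \<union> R \<Longrightarrow> k \<in> K \<Longrightarrow> t \<otimes> k \<otimes> inv t \<in> K"
    and simple: "simple_group (G\<lparr>carrier := K\<rparr>)"
    and "x \<in> K" "y \<in> K" and noncomm: "x \<otimes> y \<noteq> y \<otimes> x"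
  shows "K \<subseteq> L \<or> K \<subseteq> R"
proof (rule ccontr)
  assume *: "\<not> (K \<subseteq> L \<or> K \<subseteq> R)"
  note [simp] = subgroup.mem_carrier[OF L] subgroup.mem_carrier[OF R] subgroup.mem_carrier[OF K]
  \<comment> \<open>To be used with \<open>M\<close> equal to \<open>L\<close> and to
    \<open>R\<close>. Because \<open>K\<close> is simple and normalizes \<open>M\<close> without
    lying in it, the intersection of \<open>K\<close> and \<open>M\<close> is trivial.\<close>
  have centralizes: "m \<otimes> k = k \<otimes> m"
    if M: "subgroup M G" and M_LR: "M \<subseteq> L \<union> R" and "\<not> K \<subseteq> M"
      and M_norm: "\<And>k m. k \<in> K \<Longrightarrow> m \<in> M \<Longrightarrow> k \<otimes> m \<otimes> inv k \<in> M"
      and m: "m \<in> M" and k: "k \<in> K" for M m k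
  proof -
    note [simp] = subgroup.mem_carrier[OF M]
    have "K \<inter> M = {\<one>} \<or> K \<inter> M = K"
      using K M M_norm
      by (intro simple_subgroupD[OF K simple] subgroups_Inter_pair)
        (auto simp: subgroup.m_closed subgroup.m_inv_closed)
    then have KM: "K \<inter> M = {\<one>}"
      using \<open>\<not> K \<subseteq> M\<close> by auto
    \<comment> \<open>The commutator of \<open>m\<close> and \<open>k\<close> lies in
      \<open>K\<close> because \<open>m\<close> normalizes \<open>K\<close>, and in \<open>M\<close>
      because \<open>k\<close> normalizes \<open>M\<close>; hence it is trivial.\<close>
    have "m \<otimes> k \<otimes> inv m \<otimes> inv k \<in> K"
      using norm[of m k] m k M_LR K by (auto simp: subgroup.m_closed subgroup.m_inv_closed)
    moreover have "m \<otimes> (k \<otimes> inv m \<otimes> inv k) \<in> M"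
      using M_norm[of k "inv m"] m k M by (auto simp: subgroup.m_closed subgroup.m_inv_closed)
    ultimately have "m \<otimes> k \<otimes> inv m \<otimes> inv k = \<one>"
      using KM m k by (auto simp: m_assoc)
    then have "m \<otimes> k \<otimes> inv m = k"
      using m k by (metis inv_equality inv_closed inv_inv m_closed subgroup.mem_carrier[OF K] subgroup.mem_carrier[OF M])
    then show ?thesis
      using m k by (simp add: conj_eq_iff)
  qed
  note norm_LR = commuting_product_normalizes[OF L R comm, OF _ _ subsetD[OF K_LR]]
  have "l \<otimes> k = k \<otimes> l" if "l \<in> L" "k \<in> K" for l k
    using centralizes[OF L] norm_LR(1) * that by auto
  moreover have "r \<otimes> k = k \<otimes> r" if "r \<in> R" "k \<in> K" for r k
    using centralizes[OF R] norm_LR(2) * that by auto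
  moreover obtain a b where ab: "a \<in> L" "b \<in> R" "x = a \<otimes> b"
    using K_LR \<open>x \<in> K\<close> unfolding set_mult_def by blast
  ultimately have "x \<otimes> y = y \<otimes> x"
    using \<open>y \<in> K\<close> by (metis m_assoc subgroup.mem_carrier[OF L] subgroup.mem_carrier[OF R] subgroup.mem_carrier[OF K])
  then show False using noncomm by contradiction
qed

text \<open>The map \<open>h\<close> restricts to an isomorphism from \<open>S\<close> onto its
  image. This serves both for conjugates of a simple factor and for embedding the socle into
  \<open>Sym G\<close> as left or right multiplications.\<close>

lemma (in group) simple_image:
  assumes "group H" "h \<in> hom G H" "inj_on h S" "subgroup S G" "simple_group (G\<lparr>carrier := S\<rparr>)"
  shows "subgroup (h ` S) H" "simple_group (H\<lparr>carrier := h ` S\<rparr>)"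
proof -
  interpret group_hom G H h
    using assms group_axioms by (simp add: group_hom_def group_hom_axioms_def)
  show sub: "subgroup (h ` S) H"
    by (rule subgroup_img_is_subgroup[OF assms(4)])
  have "h \<in> iso (G\<lparr>carrier := S\<rparr>) (H\<lparr>carrier := h ` S\<rparr>)"
    using assms(3) subgroup.mem_carrier[OF assms(4)]
    by (auto simp: iso_def hom_def bij_betw_def)
  then show "simple_group (H\<lparr>carrier := h ` S\<rparr>)"
    using simple_group.iso_simple[OF assms(5)] group.subgroup_imp_group[OF assms(1) sub] by blast
qed

text \<open>Conjugation by \<open>f\<close> is an automorphism preserving \<open>L <#> R\<close>, so
  it sends each factor to a nonabelian simple subgroup normalized by \<open>L\<close> and
  \<open>R\<close>. Such a subgroup lies in \<open>L\<close> or in \<open>R\<close>, and equal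
  orders force equality. By injectivity the two images are different.\<close>

lemma (in group) normalizer_permutes_simple_factors:
  assumes L: "subgroup L G" and R: "subgroup R G"
    and comm: "\<And>l r. l \<in> L \<Longrightarrow> r \<in> R \<Longrightarrow> l \<otimes> r = r \<otimes> l"
    and simple: "simple_group (G\<lparr>carrier := L\<rparr>)" "simple_group (G\<lparr>carrier := R\<rparr>)"
    and nonab: "\<exists>x\<in>L. \<exists>y\<in>L. x \<otimes> y \<noteq> y \<otimes> x" "\<exists>x\<in>R. \<exists>y\<in>R. x \<otimes> y \<noteq> y \<otimes> x"
    and card: "finite L" "finite R" "card L = card R"
    and f: "f \<in> normalizer G (L <#> R)"
  defines "c \<equiv> \<lambda>t. f \<otimes> t \<otimes> inv f"
  shows "(c ` L = L \<and> c ` R = R) \<or> (c ` L = R \<and> c ` R = L)"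
proof -
  note [simp] = subgroup.mem_carrier[OF L] subgroup.mem_carrier[OF R]
  have LR_carrier: "L <#> R \<subseteq> carrier G"
    by (auto simp: set_mult_def)
  have fG: "f \<in> carrier G" and cT: "c ` (L <#> R) = L <#> R"
    using f normalizer_iff[OF LR_carrier] by (auto simp: c_def)
  have c_hom: "c \<in> hom G G" and c_inj: "inj_on c (carrier G)"
    using conj_hom inj_on_conj fG by (auto simp: c_def)
  interpret c: group_hom G G c
    using c_hom by unfold_locales
  have "l \<otimes> \<one> \<in> L <#> R" "\<one> \<otimes> r \<in> L <#> R" if "l \<in> L" "r \<in> R" for l r
    using that subgroup.one_closed[OF L] subgroup.one_closed[OF R] unfolding set_mult_def by blast+
  then have sub_LR: "L \<subseteq> L <#> R" "R \<subseteq> L <#> R"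
    using subgroup.one_closed[OF L] subgroup.one_closed[OF R] by (auto simp: subset_iff)
  have factor: "c ` K = L \<or> c ` K = R"
    if K: "subgroup K G" and sK: "simple_group (G\<lparr>carrier := K\<rparr>)"
      and KT: "K \<subseteq> L <#> R" and cK: "card K = card L"
      and nK: "\<And>t k. t \<in> L <#> R \<Longrightarrow> k \<in> K \<Longrightarrow> t \<otimes> k \<otimes> inv t \<in> K"
      and x: "x \<in> K" and y: "y \<in> K" and xy: "x \<otimes> y \<noteq> y \<otimes> x" for K x y
  proof -
    have KG: "K \<subseteq> carrier G" using K by (rule subgroup.subset)
    have K': "subgroup (c ` K) G" "simple_group (G\<lparr>carrier := c ` K\<rparr>)"
      using simple_image[OF group_axioms c_hom inj_on_subset[OF c_inj KG] K sK] by auto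
    have "c ` K \<subseteq> L \<or> c ` K \<subseteq> R"
    proof (rule simple_subgroup_of_commuting_product[OF L R K'(1) comm _ _ K'(2)])
      show "c ` K \<subseteq> L <#> R" using KT cT by auto
      show "c x \<in> c ` K" "c y \<in> c ` K" using x y by auto
      have xyG: "x \<in> carrier G" "y \<in> carrier G" using x y KG by auto
      then have "c (x \<otimes> y) \<noteq> c (y \<otimes> x)"
        using xy inj_on_eq_iff[OF c_inj] m_closed by metis
      then show "c x \<otimes> c y \<noteq> c y \<otimes> c x" using xyG by simp
    next
      fix t k assume t: "t \<in> L \<union> R" and k: "k \<in> c ` K"
      \<comment> \<open>As \<open>c\<close> maps \<open>L <#> R\<close> onto itself,
        \<open>t\<close> is \<open>c s\<close> for some \<open>s\<close> there. Conjugating the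
        image of \<open>K\<close> by \<open>t\<close> thus amounts to conjugating \<open>K\<close>
        by \<open>s\<close> and then applying \<open>c\<close>.\<close>
      have "t \<in> c ` (L <#> R)"
        unfolding cT using t sub_LR by blast
      with k obtain s j where "s \<in> L <#> R" "t = c s" "j \<in> K" "k = c j"
        by blast
      moreover from this have "s \<in> carrier G" "j \<in> carrier G"
        using LR_carrier KG by auto
      ultimately have "t \<otimes> k \<otimes> inv t = c (s \<otimes> j \<otimes> inv s)" "s \<otimes> j \<otimes> inv s \<in> K"
        using nK by auto
      then show "t \<otimes> k \<otimes> inv t \<in> c ` K" by simp
    qed auto
    moreover have "card (c ` K) = card L"
      using inj_on_subset[OF c_inj KG] cK by (simp add: card_image)
    ultimately show ?thesis
      using card by (metis card_subset_eq)
  qed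
  note norm_LR = commuting_product_normalizes[OF L R comm]
  obtain x y where "x \<in> L" "y \<in> L" "x \<otimes> y \<noteq> y \<otimes> x"
    using nonab(1) by blast
  \<comment> \<open>The factors differ because \<open>L = R\<close> would make the nonabelian group
    \<open>L\<close> commute with itself.\<close>
  then have 1: "c ` L = L \<or> c ` L = R" and "L \<noteq> R"
    using factor[OF L simple(1) sub_LR(1) refl norm_LR(1)] comm by auto
  obtain x y where "x \<in> R" "y \<in> R" "x \<otimes> y \<noteq> y \<otimes> x"
    using nonab(2) by blast
  then have 2: "c ` R = L \<or> c ` R = R"
    using factor[OF R simple(2) sub_LR(2) card(3)[symmetric] norm_LR(2)] by auto
  have "c ` L \<noteq> c ` R"
    using \<open>L \<noteq> R\<close> c_inj L R by (simp add: inj_on_image_eq_iff subgroup.subset)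
  with 1 2 show ?thesis by auto
qed

section \<open>Two-sided multiplications\<close>

text \<open>A common form for left multiplications (\<open>b = \<one>\<close>), right
  multiplications (\<open>a = \<one>\<close>) and the elements of \<open>star G L\<close>. It is
  undefined off the carrier, as membership in \<open>BijGroup\<close> demands.\<close>

definition bimult :: "('a, 'b) monoid_scheme \<Rightarrow> 'a \<Rightarrow> 'a \<Rightarrow> 'a \<Rightarrow> 'a" where
  "bimult G a b = (\<lambda>g\<in>carrier G. a \<otimes>\<^bsub>G\<^esub> g \<otimes>\<^bsub>G\<^esub> b)"

lemma bimult_apply [simp]: "g \<in> carrier G \<Longrightarrow> bimult G a b g = a \<otimes>\<^bsub>G\<^esub> g \<otimes>\<^bsub>G\<^esub> b"
  by (simp add: bimult_def)

lemma (in group) inv_cancel: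
  assumes "x \<in> carrier G" "y \<in> carrier G"
  shows "inv x \<otimes> (x \<otimes> y) = y" "x \<otimes> (inv x \<otimes> y) = y"
  using assms by (simp_all flip: m_assoc)

lemma (in group) bimult_Bij:
  assumes "a \<in> carrier G" "b \<in> carrier G"
  shows "bimult G a b \<in> Bij (carrier G)"
proof -
  have "bij_betw (bimult G a b) (carrier G) (carrier G)"
    by (rule bij_betw_byWitness[where f' = "\<lambda>g. inv a \<otimes> g \<otimes> inv b"])
      (use assms in \<open>auto simp: m_assoc inv_cancel\<close>)
  then show ?thesis
    by (auto simp: Bij_def bimult_def)
qed

lemma (in group) bimult_mult:
  assumes "a \<in> carrier G" "b \<in> carrier G" "c \<in> carrier G" "d \<in> carrier G"
  shows "bimult G a b \<otimes>\<^bsub>Sym G\<^esub> bimult G c d = bimult G (a \<otimes> c) (d \<otimes> b)"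
proof -
  have "bimult G a b \<otimes>\<^bsub>Sym G\<^esub> bimult G c d = compose (carrier G) (bimult G a b) (bimult G c d)"
    using assms by (simp add: BijGroup_def bimult_Bij)
  also have "\<dots> = bimult G (a \<otimes> c) (d \<otimes> b)"
    unfolding compose_def bimult_def using assms by (intro restrict_ext) (simp add: m_assoc)
  finally show ?thesis .
qed

lemma (in group) left_mults_eq:
  assumes "L \<subseteq> carrier G"
  shows "left_mults G L = (\<lambda>a. bimult G a \<one>) ` L"
proof -
  have "(\<lambda>g\<in>carrier G. x \<otimes> g) = bimult G x \<one>" if "x \<in> L" for x
    unfolding bimult_def using that assms by (intro restrict_ext) auto
  then show ?thesis
    unfolding left_mults_def Setcompr_eq_image by (intro image_cong) auto
qed

lemma (in group) right_mults_eq: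
  "right_mults G L = (\<lambda>b. bimult G \<one> b) ` L"
proof -
  have "(\<lambda>g\<in>carrier G. g \<otimes> x) = bimult G \<one> x" for x
    unfolding bimult_def by (intro restrict_ext) auto
  then show ?thesis
    unfolding right_mults_def Setcompr_eq_image by (intro image_cong) auto
qed

text \<open>Right multiplications compose in reverse order, so parametrizing them by
  \<open>b\<close> gives an antihomomorphism. The inverse turns it into a homomorphism and,
  \<open>L\<close> being closed under inverses, leaves the image unchanged.\<close>

lemma (in group) right_mults_eq_inv:
  assumes "subgroup L G"
  shows "right_mults G L = (\<lambda>b. bimult G \<one> (inv b)) ` L"
proof -
  have "m_inv G ` L = L"
  proof
    show "m_inv G ` L \<subseteq> L" using assms by (auto simp: subgroup.m_inv_closed)
    show "L \<subseteq> m_inv G ` L"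
      using assms by (metis image_eqI inv_inv subgroup.m_inv_closed subgroup.mem_carrier subsetI)
  qed
  then show ?thesis by (metis right_mults_eq image_image)
qed

lemma (in group) star_eq:
  assumes "L \<subseteq> carrier G"
  shows "star G L = {bimult G a b | a b. a \<in> L \<and> b \<in> L}"
proof -
  have "bimult G a \<one> \<otimes>\<^bsub>Sym G\<^esub> bimult G \<one> b = bimult G a b" if "a \<in> L" "b \<in> L" for a b
    using that assms by (simp add: bimult_mult subset_iff)
  then show ?thesis
    unfolding star_def left_mults_eq[OF assms] right_mults_eq set_mult_def by force
qed

lemma (in group) bimult_left_hom: "(\<lambda>a. bimult G a \<one>) \<in> hom G (Sym G)"
  by (intro homI) (auto simp: bimult_mult bimult_Bij, simp add: BijGroup_def bimult_Bij)

lemma (in group) bimult_right_hom: "(\<lambda>b. bimult G \<one> (inv b)) \<in> hom G (Sym G)"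
  by (intro homI) (auto simp: bimult_mult bimult_Bij inv_mult_group, simp add: BijGroup_def bimult_Bij)

lemma (in group) bimult_left_inj: "inj_on (\<lambda>a. bimult G a \<one>) (carrier G)"
  by (intro inj_onI) (auto dest!: fun_cong[where x = \<one>])

lemma (in group) bimult_right_inj: "inj_on (\<lambda>b. bimult G \<one> (inv b)) (carrier G)"
proof (rule inj_onI)
  fix x y assume xy: "x \<in> carrier G" "y \<in> carrier G"
    and "bimult G \<one> (inv x) = bimult G \<one> (inv y)"
  then have "inv x = inv y" by (auto dest!: fun_cong[where x = \<one>])
  then show "x = y" using xy by (metis inv_inv)
qed

section \<open>The socle\<close>

lemma (in group) socle_normal: "socle G \<lhd> G"
  unfolding socle_def
proof (rule normal_generateI)
  show "\<Union> {M. minimal_normal G M} \<subseteq> carrier G"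
    by (auto simp: minimal_normal_def dest: normal_imp_subgroup subgroup.mem_carrier)
  fix m g assume "m \<in> \<Union> {M. minimal_normal G M}" "g \<in> carrier G"
  then show "g \<otimes> m \<otimes> inv g \<in> \<Union> {M. minimal_normal G M}"
    by (auto simp: minimal_normal_def intro: normal.inv_op_closed2)
qed

lemma minimal_normal_subset_socle: "minimal_normal G M \<Longrightarrow> M \<subseteq> socle G"
  unfolding socle_def by (auto intro: generate.incl)

text \<open>Descent on the finite set \<open>K\<close>: if \<open>K\<close> is not itself minimal,
  it properly contains a smaller nontrivial normal subgroup.\<close>

lemma (in group) minimal_normal_exists:
  assumes "finite K" "K \<lhd> G" "K \<noteq> {\<one>}"
  obtains M where "minimal_normal G M" "M \<subseteq> K"
proof -
  have "\<exists>M. minimal_normal G M \<and> M \<subseteq> K"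
    using assms
  proof (induction K rule: finite_psubset_induct)
    case (psubset K)
    show ?case
    proof (cases "minimal_normal G K")
      case False
      then obtain J where "J \<lhd> G" "J \<subset> K" "J \<noteq> {\<one>}"
        using psubset.prems by (auto simp: minimal_normal_def)
      then show ?thesis
        using psubset.IH[of J] by (metis psubset_imp_subset subset_trans)
    qed auto
  qed
  then show thesis using that by blast
qed

text \<open>The inverse automorphism pulls any normal subgroup inside the image of \<open>M\<close>
  back to one inside \<open>M\<close>, where minimality decides.\<close>

lemma (in group) iso_minimal_normal:
  assumes "h \<in> iso G G" "minimal_normal G M"
  shows "minimal_normal G (h ` M)"
proof -
  interpret group_hom G G h
    using assms by unfold_locales (simp add: iso_def)
  let ?k = "inv_into (carrier G) h"
  have bij: "bij_betw h (carrier G) (carrier G)" and k: "?k \<in> iso G G"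
    using assms(1) iso_set_sym[OF assms(1)] by (auto simp: Group.iso_iff bij_betw_def)
  have M: "M \<lhd> G" "M \<noteq> {\<one>}" "\<And>J. J \<lhd> G \<Longrightarrow> J \<subseteq> M \<Longrightarrow> J = {\<one>} \<or> J = M"
    using assms(2) by (auto simp: minimal_normal_def)
  have MG: "M \<subseteq> carrier G" using M(1) normal_imp_subgroup subgroup.subset by blast
  have kh: "?k ` h ` M = M"
    using bij MG by (simp add: bij_betw_def inv_into_image_cancel)
  have "J = {\<one>} \<or> J = h ` M" if J: "J \<lhd> G" "J \<subseteq> h ` M" for J
  proof -
    have "?k ` J \<lhd> G" using J(1) k iso_normal_subgroup is_group by blast
    moreover have "?k ` J \<subseteq> M" using J(2) kh by blast
    ultimately have "?k ` J = {\<one>} \<or> ?k ` J = M" by (rule M(3))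
    moreover have "h ` ?k ` J = J"
      using bij J(1) normal_imp_subgroup subgroup.subset
      by (metis bij_betw_def image_inv_into_cancel)
    ultimately show ?thesis by (metis hom_one image_empty image_insert)
  qed
  moreover have "h ` M \<lhd> G" using M(1) assms(1) iso_normal_subgroup is_group by blast
  moreover have "h ` M \<noteq> {\<one>}"
    using M(2) kh bij hom_one by (metis bij_betw_def image_empty image_insert inv_into_f_f one_closed)
  ultimately show ?thesis by (auto simp: minimal_normal_def)
qed

text \<open>Automorphisms send minimal normal subgroups to minimal normal subgroups, hence
  generators of the socle to generators.\<close>

lemma (in group) iso_socle_subset:
  assumes "h \<in> iso G G"
  shows "h ` socle G \<subseteq> socle G"
proof -
  interpret group_hom G G h
    using assms by unfold_locales (simp add: iso_def)
  let ?U = "\<Union> {M. minimal_normal G M}"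
  have "?U \<subseteq> carrier G"
    by (auto simp: minimal_normal_def dest: normal_imp_subgroup subgroup.mem_carrier)
  then have "h ` socle G = generate G (h ` ?U)"
    unfolding socle_def by (simp add: generate_img)
  also have "\<dots> \<subseteq> socle G"
    unfolding socle_def using iso_minimal_normal[OF assms] by (intro mono_generate) blast
  finally show ?thesis .
qed

section \<open>The normalizer of \<open>S\<^sup>*\<close>\<close>

locale finite_almost_simple_group = group G for G (structure) +
  assumes finite_carrier: "finite (carrier G)"
    and almost_simple: "almost_simple G"
begin

abbreviation S where "S \<equiv> socle G"

lemma S_subgroup: "subgroup S G"
  using socle_normal normal_imp_subgroup by blast

lemma S_carrier [simp]: "x \<in> S \<Longrightarrow> x \<in> carrier G"
  by (rule subgroup.mem_carrier[OF S_subgroup])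

lemma S_subset: "S \<subseteq> carrier G"
  by auto

lemma S_simple: "simple_group (G\<lparr>carrier := S\<rparr>)"
  using almost_simple by (simp add: almost_simple_def)

lemma S_nonabelian: "\<exists>x\<in>S. \<exists>y\<in>S. x \<otimes> y \<noteq> y \<otimes> x"
proof (rule ccontr)
  assume "\<not> ?thesis"
  moreover have "group (G\<lparr>carrier := S\<rparr>)"
    using S_subgroup by (rule subgroup_imp_group)
  ultimately have "comm_group (G\<lparr>carrier := S\<rparr>)"
    by (intro group.group_comm_groupI) auto
  then show False using almost_simple by (simp add: almost_simple_def)
qed

text \<open>The centralizer \<open>C\<close> of the normal subgroup \<open>S\<close> is normal. If
  nontrivial, it contains a minimal normal subgroup \<open>M\<close> of \<open>G\<close>, which also
  lies in the socle \<open>S\<close>. Simplicity gives \<open>M = S\<close>, so \<open>S\<close>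
  centralizes itself, against its being nonabelian.\<close>

lemma S_centralizer_trivial:
  assumes "c \<in> carrier G" "\<And>s. s \<in> S \<Longrightarrow> c \<otimes> s = s \<otimes> c"
  shows "c = \<one>"
proof -
  define C where "C = {c \<in> carrier G. \<forall>s\<in>S. c \<otimes> s = s \<otimes> c}"
  interpret S: normal S G by (rule socle_normal)
  have CD: "x \<in> carrier G" "s \<in> S \<Longrightarrow> x \<otimes> s = s \<otimes> x" if "x \<in> C" for x s
    using that by (auto simp: C_def)
  have C_sub: "subgroup C G"
  proof (rule subgroupI)
    show "C \<noteq> {}" unfolding C_def using S_subset by auto
    fix x assume x: "x \<in> C"
    have "inv x \<otimes> s = s \<otimes> inv x" if "s \<in> S" for s
    proof -
      have "inv x \<otimes> s = inv x \<otimes> (s \<otimes> x) \<otimes> inv x"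
        using CD(1)[OF x] that by (simp add: m_assoc)
      also have "\<dots> = inv x \<otimes> (x \<otimes> s) \<otimes> inv x"
        using CD(2)[OF x that] by simp
      also have "\<dots> = s \<otimes> inv x"
        using CD(1)[OF x] that by (simp add: inv_cancel)
      finally show ?thesis .
    qed
    then show "inv x \<in> C" using CD[OF x] by (auto simp: C_def)
    fix y assume y: "y \<in> C"
    have "x \<otimes> y \<otimes> s = s \<otimes> (x \<otimes> y)" if "s \<in> S" for s
      using CD[OF x] CD[OF y] that by (metis S_carrier m_assoc)
    then show "x \<otimes> y \<in> C" using CD[OF x] CD[OF y] by (auto simp: C_def)
  qed (auto simp: C_def)
  have C_normal: "C \<lhd> G"
  proof (rule normal_invI[OF C_sub])
    fix g x assume g: "g \<in> carrier G" and x: "x \<in> C"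
    have "g \<otimes> x \<otimes> inv g \<otimes> s = s \<otimes> (g \<otimes> x \<otimes> inv g)" if s: "s \<in> S" for s
    proof -
      \<comment> \<open>Moving \<open>s\<close> leftwards past \<open>inv g\<close> turns it into
        \<open>t\<close>, which is again in \<open>S\<close> and so commutes with
        \<open>x\<close>.\<close>
      define t where "t = inv g \<otimes> s \<otimes> g"
      have t: "t \<in> S" "inv g \<otimes> s = t \<otimes> inv g" "g \<otimes> t = s \<otimes> g"
        using S.inv_op_closed1[OF g s] g s
        by (simp_all add: t_def m_assoc inv_cancel)
      have "g \<otimes> x \<otimes> inv g \<otimes> s = g \<otimes> (x \<otimes> t) \<otimes> inv g"
        using g s t CD(1)[OF x] by (simp add: m_assoc)
      also have "\<dots> = g \<otimes> t \<otimes> x \<otimes> inv g"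
        using g t(1) CD[OF x] by (simp add: m_assoc)
      also have "\<dots> = s \<otimes> (g \<otimes> x \<otimes> inv g)"
        using g s t CD(1)[OF x] by (simp add: m_assoc)
      finally show ?thesis .
    qed
    then show "g \<otimes> x \<otimes> inv g \<in> C"
      using g CD(1)[OF x] by (simp add: C_def)
  qed
  have "C = {\<one>}"
  proof (rule ccontr)
    assume "C \<noteq> {\<one>}"
    then obtain M where M: "minimal_normal G M" "M \<subseteq> C"
      using minimal_normal_exists[OF _ C_normal] finite_carrier CD(1) finite_subset subsetI by metis
    then have "M \<subseteq> S" "M \<lhd> G" "M \<noteq> {\<one>}"
      using minimal_normal_subset_socle by (auto simp: minimal_normal_def)
    moreover from this have "M = {\<one>} \<or> M = S"
      by (intro simple_subgroupD[OF S_subgroup S_simple])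
        (auto simp: normal_imp_subgroup normal.inv_op_closed2)
    ultimately have "S \<subseteq> C" using M by auto
    then show False using S_nonabelian CD(2) by blast
  qed
  then show ?thesis using assms by (auto simp: C_def)
qed

end

section \<open>The normalizer of \<open>star G S\<close> and the holomorph, described
  pointwise\<close>

context finite_almost_simple_group
begin

abbreviation (input) inversion where "inversion \<equiv> \<lambda>g\<in>carrier G. inv g"

lemma inversion_Bij: "inversion \<in> Bij (carrier G)"
proof -
  have "bij_betw inversion (carrier G) (carrier G)"
    by (rule bij_betw_byWitness[where f' = "m_inv G"]) auto
  then show ?thesis by (simp add: Bij_def)
qed

lemma star_subset: "star G S \<subseteq> Bij (carrier G)"
  by (auto simp: star_eq[OF S_subset] bimult_Bij)

lemma finite_star: "finite (star G S)"
proof -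
  have "star G S = (\<lambda>(a, b). bimult G a b) ` (S \<times> S)"
    by (auto simp: star_eq[OF S_subset])
  then show ?thesis
    using finite_carrier S_subset by (simp add: finite_subset)
qed

text \<open>The finite criterion for normalizers, with elements of \<open>star G S\<close> written
  as \<open>bimult G a b\<close>. The coefficients \<open>c\<close> and \<open>d\<close> may depend
  on \<open>a\<close> and \<open>b\<close> but not on \<open>g\<close>.\<close>

lemma normalizer_star_iff:
  "f \<in> normalizer (Sym G) (star G S) \<longleftrightarrow> f \<in> Bij (carrier G) \<and>
    (\<forall>a\<in>S. \<forall>b\<in>S. \<exists>c\<in>S. \<exists>d\<in>S. \<forall>g\<in>carrier G. f (a \<otimes> g \<otimes> b) = c \<otimes> f g \<otimes> d)"
proof (cases "f \<in> Bij (carrier G)")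
  case True
  then have "f g \<in> carrier G" if "g \<in> carrier G" for g
    using that Bij_imp_funcset by blast
  moreover have "(\<forall>t\<in>star G S. P t) \<longleftrightarrow> (\<forall>a\<in>S. \<forall>b\<in>S. P (bimult G a b))"
    and "(\<exists>t\<in>star G S. P t) \<longleftrightarrow> (\<exists>a\<in>S. \<exists>b\<in>S. P (bimult G a b))" for P
    unfolding star_eq[OF S_subset] by blast+
  ultimately show ?thesis
    using True by (simp add: normalizer_BijGroup_iff[OF star_subset finite_star])
qed (simp add: normalizer_BijGroup_iff[OF star_subset finite_star])

lemma Hol_iff:
  "f \<in> Hol G \<longleftrightarrow> f \<in> Bij (carrier G) \<and>
    (\<forall>x\<in>carrier G. \<exists>y\<in>carrier G. \<forall>g\<in>carrier G. f (g \<otimes> x) = f g \<otimes> y)"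
proof -
  have "right_mults G (carrier G) \<subseteq> Bij (carrier G)" "finite (right_mults G (carrier G))"
    using finite_carrier by (auto simp: right_mults_eq bimult_Bij)
  note normalizer_iff = normalizer_BijGroup_iff[OF this]
  show ?thesis
  proof (cases "f \<in> Bij (carrier G)")
    case True
    then have "f g \<in> carrier G" if "g \<in> carrier G" for g
      using that Bij_imp_funcset by blast
    then show ?thesis
      unfolding Hol_def normalizer_iff using True by (simp add: right_mults_eq)
  qed (simp add: Hol_def normalizer_iff)
qed

lemma inversion_in_normalizer: "inversion \<in> normalizer (Sym G) (star G S)"
  unfolding normalizer_star_iff
proof (intro conjI ballI inversion_Bij)
  fix a b assume "a \<in> S" "b \<in> S"
  \<comment> \<open>Inversion reverses products, so the left coefficient comes from \<open>b\<close>
    and the right one from \<open>a\<close>.\<close>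
  then show "\<exists>c\<in>S. \<exists>d\<in>S. \<forall>g\<in>carrier G. inversion (a \<otimes> g \<otimes> b) = c \<otimes> inversion g \<otimes> d"
    using S_subgroup
    by (intro bexI[of _ "inv b"] bexI[of _ "inv a"])
      (auto simp: inv_mult_group m_assoc subgroup.m_inv_closed)
qed

text \<open>An element \<open>f\<close> of the holomorph is an automorphism \<open>h\<close>
  followed by right multiplication by \<open>f \<one>\<close>, and \<open>h\<close> preserves the
  socle.\<close>

lemma Hol_subset_normalizer: "Hol G \<subseteq> normalizer (Sym G) (star G S)"
proof
  fix f assume "f \<in> Hol G"
  then have f: "f \<in> Bij (carrier G)"
    and f_right: "\<forall>x\<in>carrier G. \<exists>y\<in>carrier G. \<forall>g\<in>carrier G. f (g \<otimes> x) = f g \<otimes> y"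
    by (auto simp: Hol_iff)
  have fG [simp]: "f g \<in> carrier G" if "g \<in> carrier G" for g
    using that f Bij_imp_funcset by blast
  \<comment> \<open>The right multiplier belonging to \<open>x\<close> is found by evaluating at
    \<open>g = \<one>\<close>.\<close>
  have f_mult: "f (g \<otimes> x) = f g \<otimes> (inv (f \<one>) \<otimes> f x)" if "g \<in> carrier G" "x \<in> carrier G" for g x
  proof -
    obtain y where y: "y \<in> carrier G" "\<And>g. g \<in> carrier G \<Longrightarrow> f (g \<otimes> x) = f g \<otimes> y"
      using f_right \<open>x \<in> carrier G\<close> by blast
    have "inv (f \<one>) \<otimes> f x = y"
      using y(2)[of \<one>] y(1) that by (simp add: inv_cancel)
    then show ?thesis using y(2) that by simp
  qed
  define h where "h = (\<lambda>g. f g \<otimes> inv (f \<one>))"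
  have "h \<in> iso G G"
  proof (rule isoI)
    show "h \<in> hom G G"
      by (intro homI) (auto simp: h_def f_mult m_assoc)
    have "bij_betw (\<lambda>g. g \<otimes> inv (f \<one>)) (carrier G) (carrier G)"
      by (rule bij_betw_byWitness[where f' = "\<lambda>g. g \<otimes> f \<one>"]) (auto simp: m_assoc)
    with f show "bij_betw h (carrier G) (carrier G)"
      unfolding h_def Bij_def by (auto dest: bij_betw_trans simp: comp_def)
  qed
  then have hS: "h x \<in> S" if "x \<in> S" for x
    using iso_socle_subset that by blast
  show "f \<in> normalizer (Sym G) (star G S)"
    unfolding normalizer_star_iff
  proof (intro conjI ballI f)
    fix a b assume ab: "a \<in> S" "b \<in> S"
    \<comment> \<open>This right coefficient is a conjugate of \<open>h b\<close>, hence in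
      \<open>S\<close> by normality.\<close>
    have "inv (f \<one>) \<otimes> f b = inv (f \<one>) \<otimes> h b \<otimes> f \<one>"
      using ab by (simp add: h_def m_assoc)
    then have "inv (f \<one>) \<otimes> f b \<in> S"
      using hS[OF ab(2)] normal.inv_op_closed1[OF socle_normal] by simp
    moreover have "f (a \<otimes> g \<otimes> b) = h a \<otimes> f g \<otimes> (inv (f \<one>) \<otimes> f b)" if "g \<in> carrier G" for g
      using that ab by (simp add: f_mult h_def m_assoc)
    ultimately show "\<exists>c\<in>S. \<exists>d\<in>S. \<forall>g\<in>carrier G. f (a \<otimes> g \<otimes> b) = c \<otimes> f g \<otimes> d"
      using hS[OF ab(1)] by blast
  qed
qed

text \<open>After dividing \<open>f\<close> by \<open>f \<one>\<close>, both sides act on \<open>S\<close> through the same map, so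
  \<open>f (g \<otimes> h)\<close> and \<open>f g \<otimes> f h\<close> conjugate \<open>S\<close> in the same way and hence agree.\<close>

lemma in_Hol_if_preserves_sides:
  assumes f: "f \<in> Bij (carrier G)"
    and left: "\<And>s. s \<in> S \<Longrightarrow> \<exists>t\<in>S. \<forall>g\<in>carrier G. f (s \<otimes> g) = t \<otimes> f g"
    and right: "\<And>s. s \<in> S \<Longrightarrow> \<exists>t\<in>S. \<forall>g\<in>carrier G. f (g \<otimes> s) = f g \<otimes> t"
  shows "f \<in> Hol G"
proof -
  have fG [simp]: "f g \<in> carrier G" if "g \<in> carrier G" for g
    using that f Bij_imp_funcset by blast
  define h where "h = (\<lambda>g. f g \<otimes> inv (f \<one>))"
  have hG [simp]: "h g \<in> carrier G" if "g \<in> carrier G" for g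
    using that by (simp add: h_def)
  have h_one: "h \<one> = \<one>" by (simp add: h_def)
  have h_left: "h s \<in> S \<and> (\<forall>g\<in>carrier G. h (s \<otimes> g) = h s \<otimes> h g)" if s: "s \<in> S" for s
  proof -
    obtain t where t: "t \<in> S" "\<And>g. g \<in> carrier G \<Longrightarrow> f (s \<otimes> g) = t \<otimes> f g"
      using left[OF s] by blast
    then have ht: "h (s \<otimes> g) = t \<otimes> h g" if "g \<in> carrier G" for g
      using that by (simp add: h_def m_assoc)
    have "h s = t" using ht[of \<one>] s t h_one by simp
    then show ?thesis using ht t by simp
  qed
  have h_right: "h (g \<otimes> s) = h g \<otimes> h s" if g: "g \<in> carrier G" and s: "s \<in> S" for g s
  proof -
    obtain t where t: "t \<in> S" "\<And>g. g \<in> carrier G \<Longrightarrow> f (g \<otimes> s) = f g \<otimes> t"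
      using right[OF s] by blast
    \<comment> \<open>Dividing by \<open>f \<one>\<close> on the right conjugates the multiplier
      \<open>t\<close> by \<open>f \<one>\<close>. Evaluation at \<open>\<one>\<close> then
      identifies \<open>u\<close> with \<open>h s\<close>.\<close>
    define u where "u = f \<one> \<otimes> t \<otimes> inv (f \<one>)"
    have "h (g \<otimes> s) = h g \<otimes> u" if "g \<in> carrier G" for g
      using that t by (simp add: h_def u_def m_assoc inv_cancel)
    from this[OF g] this[of \<one>] show ?thesis using s t h_one by (simp add: u_def)
  qed
  have h_inj: "inj_on h S"
    using f by (auto simp: inj_on_def h_def Bij_def bij_betw_def)
  \<comment> \<open>Surjectivity will let every element of \<open>S\<close> be written as
    \<open>h s\<close>, so that commuting with these values means centralizing all of
    \<open>S\<close>.\<close>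
  have hS: "h ` S = S"
    using h_left h_inj finite_carrier S_subset by (intro endo_inj_surj) (auto intro: finite_subset)
  \<comment> \<open>Apply \<open>h\<close> to \<open>g \<otimes> s\<close>, first with
    \<open>s\<close> as a right factor, then with the conjugate of \<open>s\<close> as a left factor
    of \<open>g\<close>.\<close>
  have h_conj: "h g \<otimes> h s = h (g \<otimes> s \<otimes> inv g) \<otimes> h g \<and> g \<otimes> s \<otimes> inv g \<in> S"
    if g: "g \<in> carrier G" and s: "s \<in> S" for g s
  proof -
    have n: "g \<otimes> s \<otimes> inv g \<in> S"
      using normal.inv_op_closed2[OF socle_normal g s] .
    have "h g \<otimes> h s = h (g \<otimes> s \<otimes> inv g \<otimes> g)"
      using g s by (simp add: h_right m_assoc)
    then show ?thesis using h_left[OF n] g n by simp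
  qed
  have h_mult: "h (x \<otimes> y) = h x \<otimes> h y" if x: "x \<in> carrier G" and y: "y \<in> carrier G" for x y
  proof -
    \<comment> \<open>The element \<open>c\<close> measures the failure of multiplicativity at
      \<open>x\<close> and \<open>y\<close>; it will be shown to centralize
      \<open>S\<close>.\<close>
    define c where "c = inv (h (x \<otimes> y)) \<otimes> (h x \<otimes> h y)"
    have cG: "c \<in> carrier G" using x y by (simp add: c_def)
    have hc: "h (x \<otimes> y) \<otimes> c = h x \<otimes> h y"
      using x y by (simp add: c_def inv_cancel)
    have "c \<otimes> t = t \<otimes> c" if "t \<in> S" for t
    proof -
      have "t \<in> h ` S" using that by (simp add: hS)
      then obtain s where s: "s \<in> S" "t = h s" by blast
      define r where "r = y \<otimes> s \<otimes> inv y"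
      define q where "q = x \<otimes> r \<otimes> inv x"
      have r: "r \<in> S" "h y \<otimes> h s = h r \<otimes> h y"
        using h_conj[OF y s(1)] by (auto simp: r_def)
      have q: "q \<in> S" "h x \<otimes> h r = h q \<otimes> h x"
        using h_conj[OF x r(1)] by (auto simp: q_def)
      have "q = x \<otimes> y \<otimes> s \<otimes> inv (x \<otimes> y)"
        using x y s by (simp add: q_def r_def m_assoc inv_mult_group)
      \<comment> \<open>Both \<open>h (x \<otimes> y)\<close> and \<open>h x \<otimes> h y\<close>
        conjugate \<open>h s\<close> to \<open>h q\<close>, so their quotient \<open>c\<close>
        commutes with \<open>h s\<close>.\<close>
      then have xy: "h (x \<otimes> y) \<otimes> h s = h q \<otimes> h (x \<otimes> y)"
        using h_conj[of "x \<otimes> y" s] x y s by simp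
      have "h (x \<otimes> y) \<otimes> (c \<otimes> h s) = h x \<otimes> h y \<otimes> h s"
        using x y s cG by (simp add: hc flip: m_assoc)
      also have "\<dots> = h q \<otimes> (h x \<otimes> h y)"
        using x y s q r by (metis S_carrier hG m_assoc)
      also have "\<dots> = h (x \<otimes> y) \<otimes> (h s \<otimes> c)"
        using x y s q cG by (metis S_carrier hG hc m_assoc m_closed xy)
      finally show ?thesis using x y s cG by simp
    qed
    then have "c = \<one>" using S_centralizer_trivial cG by blast
    then show ?thesis using hc x y by simp
  qed
  show ?thesis
    unfolding Hol_iff
  proof (intro conjI ballI f)
    fix x assume x: "x \<in> carrier G"
    have fh: "f g = h g \<otimes> f \<one>" if "g \<in> carrier G" for g
      using that by (simp add: h_def m_assoc)
    show "\<exists>y\<in>carrier G. \<forall>g\<in>carrier G. f (g \<otimes> x) = f g \<otimes> y"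
    proof (intro bexI ballI)
      fix g assume g: "g \<in> carrier G"
      have "f (g \<otimes> x) = h g \<otimes> h x \<otimes> f \<one>"
        using g x fh[of "g \<otimes> x"] h_mult by simp
      then show "f (g \<otimes> x) = f g \<otimes> (inv (f \<one>) \<otimes> h x \<otimes> f \<one>)"
        using g x by (simp add: h_def m_assoc)
    qed (use x in simp)
  qed
qed

text \<open>Left and right multiplications by \<open>S\<close> are commuting copies of a nonabelian
  simple group with product \<open>star G S\<close>. Conjugation by \<open>f\<close> therefore fixes
  or exchanges them; the two cases are recorded as equations for \<open>f\<close>.\<close>

lemma normalizer_permutes_sides:
  assumes "f \<in> normalizer (Sym G) (star G S)"
  obtains
    (preserve) "\<And>s. s \<in> S \<Longrightarrow> \<exists>t\<in>S. \<forall>g\<in>carrier G. f (s \<otimes> g) = t \<otimes> f g"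
      "\<And>s. s \<in> S \<Longrightarrow> \<exists>t\<in>S. \<forall>g\<in>carrier G. f (g \<otimes> s) = f g \<otimes> t"
  | (swap) "\<And>s. s \<in> S \<Longrightarrow> \<exists>t\<in>S. \<forall>g\<in>carrier G. f (s \<otimes> g) = f g \<otimes> t"
      "\<And>s. s \<in> S \<Longrightarrow> \<exists>t\<in>S. \<forall>g\<in>carrier G. f (g \<otimes> s) = t \<otimes> f g"
proof -
  interpret P: group "Sym G" by (rule group_BijGroup)
  have f: "f \<in> Bij (carrier G)" using assms by (simp add: normalizer_star_iff)
  have fG [simp]: "f g \<in> carrier G" if "g \<in> carrier G" for g
    using that f Bij_imp_funcset by blast
  let ?l = "\<lambda>a. bimult G a \<one>" and ?r = "\<lambda>b. bimult G \<one> (inv b)"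
  let ?L = "left_mults G S" and ?R = "right_mults G S"
  note L = left_mults_eq[OF S_subset] and R = right_mults_eq_inv[OF S_subgroup]
  note il = inj_on_subset[OF bimult_left_inj S_subset]
  note ir = inj_on_subset[OF bimult_right_inj S_subset]
  have finite_S: "finite S" using finite_carrier S_subset finite_subset by blast
  obtain x y where xy: "x \<in> S" "y \<in> S" "x \<otimes> y \<noteq> y \<otimes> x"
    using S_nonabelian by blast
  have nonab: "\<exists>u\<in>h ` S. \<exists>v\<in>h ` S. u \<otimes>\<^bsub>Sym G\<^esub> v \<noteq> v \<otimes>\<^bsub>Sym G\<^esub> u"
    if "h \<in> hom G (Sym G)" "inj_on h (carrier G)" for h
  proof -
    have "h (x \<otimes> y) \<noteq> h (y \<otimes> x)"
      using that(2) xy by (simp add: inj_on_eq_iff)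
    then have "h x \<otimes>\<^bsub>Sym G\<^esub> h y \<noteq> h y \<otimes>\<^bsub>Sym G\<^esub> h x"
      using that(1) xy by (simp add: hom_mult)
    then show ?thesis using xy by blast
  qed
  let ?c = "\<lambda>t. f \<otimes>\<^bsub>Sym G\<^esub> t \<otimes>\<^bsub>Sym G\<^esub> inv\<^bsub>Sym G\<^esub> f"
  have disj: "(?c ` ?L = ?L \<and> ?c ` ?R = ?R) \<or> (?c ` ?L = ?R \<and> ?c ` ?R = ?L)"
  proof (rule P.normalizer_permutes_simple_factors)
    show "subgroup ?L (Sym G)" "simple_group (Sym G\<lparr>carrier := ?L\<rparr>)"
      using simple_image[OF P.group_axioms bimult_left_hom il S_subgroup S_simple] by (simp_all add: L)
    show "subgroup ?R (Sym G)" "simple_group (Sym G\<lparr>carrier := ?R\<rparr>)"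
      using simple_image[OF P.group_axioms bimult_right_hom ir S_subgroup S_simple] by (simp_all add: R)
    show "u \<otimes>\<^bsub>Sym G\<^esub> v = v \<otimes>\<^bsub>Sym G\<^esub> u" if "u \<in> ?L" "v \<in> ?R" for u v
      using that unfolding L right_mults_eq by (auto simp: bimult_mult)
    show "\<exists>u\<in>?L. \<exists>v\<in>?L. u \<otimes>\<^bsub>Sym G\<^esub> v \<noteq> v \<otimes>\<^bsub>Sym G\<^esub> u"
      unfolding L by (rule nonab[OF bimult_left_hom bimult_left_inj])
    show "\<exists>u\<in>?R. \<exists>v\<in>?R. u \<otimes>\<^bsub>Sym G\<^esub> v \<noteq> v \<otimes>\<^bsub>Sym G\<^esub> u"
      unfolding R by (rule nonab[OF bimult_right_hom bimult_right_inj])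
    show "finite ?L" "finite ?R" unfolding L R using finite_S by auto
    show "card ?L = card ?R" unfolding L R using il ir by (simp add: card_image)
    show "f \<in> normalizer (Sym G) (?L <#>\<^bsub>Sym G\<^esub> ?R)"
      using assms by (simp add: star_def)
  qed
  \<comment> \<open>The identity "\<open>f\<close> after \<open>t\<close> equals the conjugate of
    \<open>t\<close> after \<open>f\<close>", read at the point \<open>g\<close>.\<close>
  have c: "f (t g) = ?c t (f g)" if t: "t \<in> Bij (carrier G)" and g: "g \<in> carrier G" for t g
  proof -
    define u where "u = ?c t"
    have B: "f \<in> carrier (Sym G)" "t \<in> carrier (Sym G)"
      using f t by (auto simp: BijGroup_def)
    then have uB: "u \<in> carrier (Sym G)" by (simp add: u_def)
    have "f \<otimes>\<^bsub>Sym G\<^esub> t = u \<otimes>\<^bsub>Sym G\<^esub> f"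
      using P.conj_eq_iff[OF B uB] by (simp add: u_def)
    then have "compose (carrier G) f t = compose (carrier G) u f"
      using f t uB by (simp add: BijGroup_def)
    then have "f (t g) = u (f g)"
      using g by (metis compose_eq)
    then show ?thesis by (simp add: u_def)
  qed
  have left: "\<exists>u\<in>?c ` ?L. \<forall>g\<in>carrier G. f (s \<otimes> g) = u (f g)" if s: "s \<in> S" for s
  proof (intro bexI ballI)
    show "f (s \<otimes> g) = ?c (?l s) (f g)" if "g \<in> carrier G" for g
      using c[of "?l s" g] that s by (simp add: bimult_Bij)
    show "?c (?l s) \<in> ?c ` ?L" using s unfolding L by blast
  qed
  have right: "\<exists>u\<in>?c ` ?R. \<forall>g\<in>carrier G. f (g \<otimes> s) = u (f g)" if s: "s \<in> S" for s
  proof (intro bexI ballI)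
    show "f (g \<otimes> s) = ?c (bimult G \<one> s) (f g)" if "g \<in> carrier G" for g
      using c[of "bimult G \<one> s" g] that s by (simp add: bimult_Bij)
    show "?c (bimult G \<one> s) \<in> ?c ` ?R" using s unfolding right_mults_eq by blast
  qed
  have memL: "\<exists>t\<in>S. \<forall>g\<in>carrier G. u (f g) = t \<otimes> f g" if "u \<in> ?L" for u
    using that unfolding L by auto
  have memR: "\<exists>t\<in>S. \<forall>g\<in>carrier G. u (f g) = f g \<otimes> t" if "u \<in> ?R" for u
    using that unfolding right_mults_eq by auto
  from disj show thesis
  proof
    assume "?c ` ?L = ?L \<and> ?c ` ?R = ?R"
    then have eq: "?c ` ?L = ?L" "?c ` ?R = ?R" by auto
    show thesis
      by (rule preserve) (use left[unfolded eq] right[unfolded eq] memL memR in metis)+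
  next
    assume "?c ` ?L = ?R \<and> ?c ` ?R = ?L"
    then have eq: "?c ` ?L = ?R" "?c ` ?R = ?L" by auto
    show thesis
      by (rule swap) (use left[unfolded eq] right[unfolded eq] memL memR in metis)+
  qed
qed

lemma normalizer_subset_D2: "normalizer (Sym G) (star G S) \<subseteq> D2 G"
proof
  fix f assume fN: "f \<in> normalizer (Sym G) (star G S)"
  then have f: "f \<in> Bij (carrier G)" by (simp add: normalizer_star_iff)
  have fG [simp]: "f g \<in> carrier G" if "g \<in> carrier G" for g
    using that f Bij_imp_funcset by blast
  from fN show "f \<in> D2 G"
  proof (cases rule: normalizer_permutes_sides)
    case preserve
    then have "f \<in> Hol G" using in_Hol_if_preserves_sides f by blast
    then show ?thesis unfolding D2_def by (auto intro: generate.incl)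
  next
    case swap
    \<comment> \<open>Following \<open>f\<close> by inversion swaps the sides back, so
      \<open>k\<close> preserves them. Since inversion is an involution, inverting after
      \<open>k\<close> recovers \<open>f\<close>.\<close>
    define k where "k = compose (carrier G) inversion f"
    have k: "k \<in> Bij (carrier G)"
      unfolding k_def using compose_Bij[OF inversion_Bij f] .
    have k_apply: "k g = inv (f g)" if "g \<in> carrier G" for g
      using that by (simp add: k_def compose_def)
    have "k \<in> Hol G"
    proof (rule in_Hol_if_preserves_sides[OF k])
      fix s assume s: "s \<in> S"
      obtain t where "t \<in> S" "\<And>g. g \<in> carrier G \<Longrightarrow> f (s \<otimes> g) = f g \<otimes> t"
        using swap(1)[OF s] by blast
      then show "\<exists>t\<in>S. \<forall>g\<in>carrier G. k (s \<otimes> g) = t \<otimes> k g"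
        using s S_subgroup
        by (intro bexI[of _ "inv t"]) (auto simp: k_apply inv_mult_group subgroup.m_inv_closed)
      obtain t where "t \<in> S" "\<And>g. g \<in> carrier G \<Longrightarrow> f (g \<otimes> s) = t \<otimes> f g"
        using swap(2)[OF s] by blast
      then show "\<exists>t\<in>S. \<forall>g\<in>carrier G. k (g \<otimes> s) = k g \<otimes> t"
        using s S_subgroup
        by (intro bexI[of _ "inv t"]) (auto simp: k_apply inv_mult_group subgroup.m_inv_closed)
    qed
    then have "inversion \<otimes>\<^bsub>Sym G\<^esub> k \<in> D2 G"
      unfolding D2_def by (intro generate.eng generate.incl) auto
    moreover have "inversion \<otimes>\<^bsub>Sym G\<^esub> k = f"
    proof -
      have "inversion \<otimes>\<^bsub>Sym G\<^esub> k = compose (carrier G) inversion k"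
        using inversion_Bij k by (simp add: BijGroup_def)
      also have "\<dots> = f"
        using Bij_imp_extensional[OF f]
        by (intro extensionalityI[of _ "carrier G"]) (auto simp: compose_def k_apply)
      finally show ?thesis .
    qed
    ultimately show ?thesis by simp
  qed
qed

text \<open>The normalizer is a subgroup, so it contains \<open>D2 G\<close> as soon as it contains
  the holomorph and the inversion.\<close>

lemma normalizer_star_eq_D2: "normalizer (Sym G) (star G S) = D2 G"
proof
  interpret P: group "Sym G" by (rule group_BijGroup)
  have "subgroup (normalizer (Sym G) (star G S)) (Sym G)"
    using star_subset by (intro P.normalizer_imp_subgroup) (simp add: BijGroup_def)
  then show "D2 G \<subseteq> normalizer (Sym G) (star G S)"
    unfolding D2_def using Hol_subset_normalizer inversion_in_normalizer
    by (intro P.generate_subgroup_incl) auto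
qed (rule normalizer_subset_D2)

end

theorem theorem5p1:
  fixes G :: "('a, 'b) monoid_scheme"
    and S :: "'a set"
    and N :: "('a \<Rightarrow> 'a) set"
  assumes "finite (carrier G)"
    and "almost_simple G"
    and "S = socle G"
    and "N = normalizer (Sym G) (star G S)"
  shows "N = D2 G"
proof -
  interpret finite_almost_simple_group G
    using assms(1,2)
    by (auto simp: finite_almost_simple_group_def finite_almost_simple_group_axioms_def almost_simple_def)
  show ?thesis using assms normalizer_star_eq_D2 by simp
qed

end
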